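(* Let $d,d',t$ be positive integers with $t\ge 2$, and let $\mathcal{S}\colon\mathbb{R}\to\mathbb{R}_{>0}$ be an injective map with $\mathcal{S}(0)=1$. Let $W=(A,V)$ with $A\in\mathbb{R}^{d\times d}$, $V\in\mathbb{R}^{d'\times d}$, and let $\varphi_W$ be the associated traditional (normalized) self-attention mechanism. If $\varphi_W=0$, then $V=0$. Otherwise, the fiber of $\varphi_W$, i.e. the set of all $W'=(A',V')\in\mathbb{R}^{d\times d}\times\mathbb{R}^{d'\times d}$ with $\varphi_{W'}=\varphi_W$, is the singleton $\{W\}$.
   Context: The traditional self-attention mechanism associated to $W=(A,V)$ is the map $\varphi_W\colon\mathbb{R}^{d\times t}\to\mathbb{R}^{d'\times t}$ sending $X=(x_i)_{1\le i\le t}$ (with columns $x_i\in\mathbb{R}^d$) to $$\varphi_W(X)=\left(\frac1{\zeta_i}\sum_{1\le j\le t}\mathcal{S}(x_i^\top Ax_j)\,Vx_j\right)_{1\le i\le t},\qquad \zeta_i=\sum_{1\le k\le t}\mathcal{S}(x_i^\top Ax_k).$$ *)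

theory Defs
  imports "HOL-Analysis.Analysis"
begin

text \<open>
  The type \<open>real^'n^'m\<close> is that of matrices with \<open>'m\<close> rows and \<open>'n\<close> columns, so an input
  \<open>X :: real^'t^'d\<close> is a \<open>d\<close> by \<open>t\<close> matrix whose columns are the tokens.
\<close>

definition attention_normalizer ::
    "(real \<Rightarrow> real) \<Rightarrow> real^'d^'d \<Rightarrow> real^'t^'d \<Rightarrow> 't \<Rightarrow> real" where
  "attention_normalizer S A X i = (\<Sum>k\<in>UNIV. S (column i X \<bullet> (A *v column k X)))"

text \<open>
  The vector built with \<open>\<chi> i\<close> lists the output tokens as rows; \<open>transpose\<close> turns them into columns.
\<close>

definition self_attention ::
    "(real \<Rightarrow> real) \<Rightarrow> (real^'d^'d) \<times> (real^'d^'e) \<Rightarrow> real^'t^'d \<Rightarrow> real^'t^'e" where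
  "self_attention S W X = (case W of (A, V) \<Rightarrow>
     transpose (\<chi> i. (1 / attention_normalizer S A X i) *\<^sub>R
       (\<Sum>j\<in>UNIV. S (column i X \<bullet> (A *v column j X)) *\<^sub>R (V *v column j X))))"

end

theory Submission
  imports Defs
begin

text \<open>
  An input all of whose tokens equal \<open>x\<close> is mapped to \<open>V x\<close> in every column, so \<open>V\<close> is determined.
  Now replace one token by \<open>y\<close>: with \<open>n\<close> tokens, an output column belonging to \<open>x\<close> differs from
  \<open>V x\<close> by the multiple \<open>p / ((n - 1) q + p)\<close> of \<open>V y - V x\<close>, where \<open>p = S (x \<bullet> A y)\<close> and
  \<open>q = S (x \<bullet> A x)\<close>. If \<open>V x \<noteq> V y\<close>, this determines \<open>p / q\<close>; taking \<open>y = 0\<close>, where \<open>p = 1\<close>,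
  it determines \<open>q\<close>, hence \<open>p\<close>, hence \<open>x \<bullet> A y\<close>. Linearity in \<open>y\<close> and \<open>x\<close> removes the
  conditions \<open>V x \<noteq> V y\<close> and \<open>V x \<noteq> 0\<close>.
\<close>

definition tokens :: "('t \<Rightarrow> real^'d) \<Rightarrow> real^'t^'d" where
  "tokens f = (\<chi> r c. f c $ r)"

lemma column_tokens [simp]: "column j (tokens f) = f j"
  by (simp add: tokens_def column_def vec_eq_iff)

lemma column_self_attention:
  "column i (self_attention S (A, V) (tokens f)) =
    (1 / (\<Sum>j\<in>UNIV. S (f i \<bullet> (A *v f j)))) *\<^sub>R
      (\<Sum>j\<in>UNIV. S (f i \<bullet> (A *v f j)) *\<^sub>R (V *v f j))"
  by (simp add: self_attention_def attention_normalizer_def column_def transpose_def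
      tokens_def vec_eq_iff)

text \<open>Equal tokens receive equal weights, and these cancel against the normalizer because they
  are positive.\<close>

lemma self_attention_const_tokens:
  fixes A :: "real^'d^'d" and V :: "real^'d^'e"
  assumes "\<And>u. S u > 0"
  shows "column i (self_attention S (A, V) (tokens (\<lambda>_::'t::finite. x))) = V *v x"
  using assms[of "x \<bullet> (A *v x)"] by (simp add: column_self_attention sum_constant_scaleR del: sum_constant)

text \<open>Stated over any real vector space so that it serves the real normalizer as well as the
  weighted sum of values.\<close>

lemma sum_one_exception:
  fixes u v :: "'a::real_vector"
  shows "(\<Sum>j\<in>(UNIV::'t::finite set). if j = b then u else v) = real (CARD('t) - 1) *\<^sub>R v + u"
proof -
  have "(\<Sum>j\<in>UNIV. if j = b then u else v) = u + (\<Sum>j\<in>UNIV - {b}. if j = b then u else v)"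
    by (subst sum.remove[of _ b]) auto
  also have "(\<Sum>j\<in>UNIV - {b}. if j = b then u else v) = (\<Sum>j\<in>UNIV - {b}. v)"
    by (rule sum.cong) auto
  finally show ?thesis
    by (simp add: sum_constant_scaleR)
qed

text \<open>As \<open>a \<noteq> b\<close>, the query in column \<open>a\<close> is
  \<open>x\<close>; it meets \<open>m\<close> keys \<open>x\<close> of weight \<open>q\<close> and
  one key \<open>y\<close> of weight \<open>p\<close>. Writing the average around
  \<open>V *v x\<close> leaves a single scalar that depends on \<open>A\<close>.\<close>

lemma self_attention_one_exception:
  fixes A :: "real^'d^'d" and V :: "real^'d^'e" and x y :: "real^'d" and a b :: "'t::finite"
  assumes "\<And>u. S u > 0" and "a \<noteq> b"
  defines "p \<equiv> S (x \<bullet> (A *v y))" and "q \<equiv> S (x \<bullet> (A *v x))" and "m \<equiv> real (CARD('t) - 1)"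
  shows "column a (self_attention S (A, V) (tokens (\<lambda>j. if j = b then y else x))) =
    V *v x + (p / (m * q + p)) *\<^sub>R (V *v y - V *v x)"
proof -
  have pos: "m * q + p > 0"
    using assms(1) by (simp add: p_def q_def m_def add_nonneg_pos less_imp_le)
  have norm: "(\<Sum>j\<in>UNIV. S (x \<bullet> (A *v (if j = b then y else x)))) = m * q + p"
    using sum_one_exception[of b p q]
    by (simp only: p_def q_def m_def real_scaleR_def if_distrib[of "\<lambda>z. S (x \<bullet> (A *v z))"])
  have total: "(\<Sum>j\<in>UNIV. S (x \<bullet> (A *v (if j = b then y else x))) *\<^sub>R (V *v (if j = b then y else x)))
      = (m * q) *\<^sub>R (V *v x) + p *\<^sub>R (V *v y)"
    using sum_one_exception[of b "p *\<^sub>R (V *v y)" "q *\<^sub>R (V *v x)"]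
    by (simp only: p_def q_def m_def scaleR_scaleR
        if_distrib[of "\<lambda>z. S (x \<bullet> (A *v z)) *\<^sub>R (V *v z)"])
  have "(1 / (m * q + p)) *\<^sub>R ((m * q) *\<^sub>R u + p *\<^sub>R v) = u + (p / (m * q + p)) *\<^sub>R (v - u)"
    for u v :: "real^'e"
    using pos by (simp add: vec_eq_iff field_simps)
  then show ?thesis
    using \<open>a \<noteq> b\<close> by (simp add: column_self_attention norm total)
qed

lemma self_attention_eq_imp_value_eq:
  fixes A A' :: "real^'d^'d" and V V' :: "real^'d^'e"
  assumes "\<And>u. S u > 0"
    and "(self_attention S (A, V) :: real^'t::finite^'d \<Rightarrow> _) = self_attention S (A', V')"
  shows "V = V'"
proof -
  \<comment> \<open>Every output column carries the same value here, so \<open>undefined\<close>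
    merely names some position.\<close>
  have "V *v x = V' *v x" for x
    using self_attention_const_tokens[where S=S and 't='t, OF assms(1), of undefined A V x]
      self_attention_const_tokens[where S=S and 't='t, OF assms(1), of undefined A' V' x] assms(2)
    by simp
  then show ?thesis
    by (simp add: matrix_eq)
qed

lemma self_attention_eq_imp_weight_ratio_eq:
  fixes A A' :: "real^'d^'d" and V :: "real^'d^'e"
  assumes card: "CARD('t::finite) \<ge> 2" and pos: "\<And>u. S u > 0"
    and eq: "(self_attention S (A, V) :: real^'t^'d \<Rightarrow> _) = self_attention S (A', V)"
    and neq: "V *v x \<noteq> V *v y"
  shows "S (x \<bullet> (A *v y)) * S (x \<bullet> (A' *v x)) = S (x \<bullet> (A' *v y)) * S (x \<bullet> (A *v x))"
proof -
  \<comment> \<open>Two or more tokens give both a position away from the exceptional one and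
    \<open>m > 0\<close>.\<close>
  obtain a b :: 't where "a \<noteq> b"
    using card card_le_Suc0_iff_eq[of "UNIV :: 't set"] by auto
  define m where "m = real (CARD('t) - 1)"
  define p q p' q' where "p = S (x \<bullet> (A *v y))" and "q = S (x \<bullet> (A *v x))"
    and "p' = S (x \<bullet> (A' *v y))" and "q' = S (x \<bullet> (A' *v x))"
  have "m > 0"
    using card by (simp add: m_def)
  have pq: "p > 0" "q > 0" "p' > 0" "q' > 0"
    by (simp_all add: p_def q_def p'_def q'_def pos)
  have den: "m * q + p > 0" "m * q' + p' > 0"
    using pq \<open>m > 0\<close> by (simp_all add: add_pos_pos)
  have "(p / (m * q + p)) *\<^sub>R (V *v y - V *v x) = (p' / (m * q' + p')) *\<^sub>R (V *v y - V *v x)"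
    using self_attention_one_exception[where S=S and A=A and V=V and x=x and y=y, OF pos \<open>a \<noteq> b\<close>]
      self_attention_one_exception[where S=S and A=A' and V=V and x=x and y=y, OF pos \<open>a \<noteq> b\<close>] eq
    by (auto simp: p_def q_def p'_def q'_def m_def)
  then have "p / (m * q + p) = p' / (m * q' + p')"
    using neq by simp
  then have "p * (m * q' + p') = p' * (m * q + p)"
    using den by (simp add: frac_eq_eq)
  \<comment> \<open>The products \<open>p * p'\<close> on both sides cancel.\<close>
  then have "m * (p * q') = m * (p' * q)"
    by (simp add: algebra_simps)
  then show ?thesis
    using \<open>m > 0\<close> by (simp add: p_def q_def p'_def q'_def)
qed

lemma self_attention_eq_imp_bilinear_eq:
  fixes A A' :: "real^'d^'d" and V :: "real^'d^'e"
  assumes card: "CARD('t::finite) \<ge> 2" and pos: "\<And>u. S u > 0" and inj: "inj S" and "S 0 = 1"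
    and eq: "(self_attention S (A, V) :: real^'t^'d \<Rightarrow> _) = self_attention S (A', V)"
    and "V *v x \<noteq> 0"
  shows "x \<bullet> (A *v y) = x \<bullet> (A' *v y)"
proof -
  note ratio = self_attention_eq_imp_weight_ratio_eq[OF card pos eq]
  \<comment> \<open>For \<open>y = 0\<close> both exceptional weights are \<open>S 0 = 1\<close>,
    and the condition of \<open>ratio\<close> becomes \<open>V *v x \<noteq> 0\<close>.\<close>
  have diag: "S (x \<bullet> (A' *v x)) = S (x \<bullet> (A *v x))"
    using ratio[of x 0] \<open>V *v x \<noteq> 0\<close> \<open>S 0 = 1\<close> by simp
  have generic: "x \<bullet> (A *v z) = x \<bullet> (A' *v z)" if "V *v x \<noteq> V *v z" for z
    using ratio[OF that] diag pos[of "x \<bullet> (A *v x)"] inj by (simp add: inj_eq)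
  show ?thesis
  proof (cases "V *v x = V *v y")
    case True
    \<comment> \<open>Doubling \<open>y\<close> leaves the excluded case, as
      \<open>V *v (y + y)\<close> is twice the nonzero vector \<open>V *v x\<close>; the identity
      for \<open>y + y\<close> is then halved.\<close>
    then have "V *v x \<noteq> V *v (y + y)"
      using \<open>V *v x \<noteq> 0\<close> by (metis add_cancel_left_left matrix_vector_right_distrib)
    then show ?thesis
      using generic[of "y + y"] unfolding matrix_vector_right_distrib inner_add_right by simp
  next
    case False
    then show ?thesis
      by (rule generic)
  qed
qed

lemma self_attention_eq_imp_score_eq:
  fixes A A' :: "real^'d^'d" and V :: "real^'d^'e"
  assumes "CARD('t::finite) \<ge> 2" and "\<And>u. S u > 0" and "inj S" and "S 0 = 1"
    and "(self_attention S (A, V) :: real^'t^'d \<Rightarrow> _) = self_attention S (A', V)"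
    and "V \<noteq> 0"
  shows "A = A'"
proof -
  note bilinear = self_attention_eq_imp_bilinear_eq[OF assms(1-5)]
  obtain v where v: "V *v v \<noteq> 0"
    using \<open>V \<noteq> 0\<close> by (metis matrix_eq matrix_vector_mult_0)
  have "x \<bullet> (A *v y) = x \<bullet> (A' *v y)" for x y
  proof (cases "V *v x = 0")
    case True
    \<comment> \<open>Shifting by \<open>v\<close> moves \<open>x\<close> out of the kernel of
      \<open>V\<close>; the identity for \<open>v\<close> is subtracted afterwards.\<close>
    then have "V *v (x + v) \<noteq> 0"
      using v by (simp add: matrix_vector_right_distrib)
    then have "(x + v) \<bullet> (A *v y) = (x + v) \<bullet> (A' *v y)"
      by (rule bilinear)
    then show ?thesis
      using bilinear[OF v, of y] by (simp add: inner_add_left)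
  next
    case False
    then show ?thesis
      by (rule bilinear)
  qed
  then have "A *v y = A' *v y" for y
    using vector_eq_ldot by blast
  then show ?thesis
    by (simp add: matrix_eq)
qed

theorem theorem3p9:
  fixes S :: "real \<Rightarrow> real"
    and A :: "real^'d^'d"
    and V :: "real^'d^'e"
    and \<phi> :: "(real^'d^'d) \<times> (real^'d^'e) \<Rightarrow> real^'t^'d \<Rightarrow> real^'t^'e"
  defines "\<phi> \<equiv> self_attention S"
  assumes "CARD('t) \<ge> 2"
    and "\<And>u. S u > 0"
    and "inj S"
    and "S 0 = 1"
  shows "(\<phi> (A, V) = (\<lambda>X. 0) \<longrightarrow> V = 0) \<and>
    (\<phi> (A, V) \<noteq> (\<lambda>X. 0) \<longrightarrow> {W'. \<phi> W' = \<phi> (A, V)} = {(A, V)})"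
proof -
  have zero: "self_attention S (A, 0) = (\<lambda>X :: real^'t^'d. 0 :: real^'t^'e)"
    by (simp add: fun_eq_iff self_attention_def transpose_def vec_eq_iff)
  have value_eq: "V = V'" if "\<phi> (A, V) = \<phi> (A', V')" for A' V'
    using self_attention_eq_imp_value_eq[OF assms(3), where 't='t] that by (simp add: \<phi>_def)
  have "W' = (A, V)" if nonzero: "\<phi> (A, V) \<noteq> (\<lambda>X. 0)" and eq: "\<phi> W' = \<phi> (A, V)" for W'
  proof -
    obtain A' V' where W': "W' = (A', V')"
      by fastforce
    \<comment> \<open>The values are settled first, since the comparison of \<open>A\<close> with
      \<open>A'\<close> presupposes a common \<open>V\<close>.\<close>
    have "V = V'"
      using value_eq[of A' V'] eq by (simp add: W')
    moreover have "V \<noteq> 0"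
      using nonzero zero by (auto simp: \<phi>_def)
    ultimately show ?thesis
      using self_attention_eq_imp_score_eq[OF assms(2-5), of A V A'] eq by (simp add: W' \<phi>_def)
  qed
  \<comment> \<open>The zero map is the mechanism of \<open>(A, 0)\<close>, so \<open>V\<close> is
    compared with \<open>0\<close>.\<close>
  moreover have "V = 0" if "\<phi> (A, V) = (\<lambda>X. 0)"
    using value_eq[of A 0] that zero by (simp add: \<phi>_def)
  ultimately show ?thesis
    by auto
qed

end
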